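(* Let $R$ be a ring with unit $1$, let $a,\delta a\in R$ and $\bar a=a+\delta a$, and suppose that the group inverses $a^\#$ and $\bar a^\#$ exist. If $K(a,\bar a)=\bar a\bar a^\#+aa^\#-1$ is invertible in $R$, then $$\Phi(a)=1+\delta a\,a^\pi\,\delta a\,\big[(1+a^\#\delta a)^{-1}a^\#\big]^2$$ is invertible in $R$, where $a^\pi=1-a^\#a$.
   Context: For $x$ in a ring $R$ with unit (not necessarily commutative), the group inverse of $x$, denoted $x^\#$, is the (unique, if it exists) element $y\in R$ with $xyx=x$, $yxy=y$, $xy=yx$. Here $\delta a$ denotes a single element of $R$ (the perturbation of $a$), not a product. The expression $\Phi(a)$ is well defined: when $K(a,\bar a)$ is invertible, the element $1+a^\#\delta a$ is invertible in $R$. *)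

theory Defs
  imports "HOL-Algebra.Ring"
begin

definition is_group_inverse :: "('a, 'm) ring_scheme \<Rightarrow> 'a \<Rightarrow> 'a \<Rightarrow> bool" where
  "is_group_inverse R x y \<longleftrightarrow>
     y \<in> carrier R \<and>
     x \<otimes>\<^bsub>R\<^esub> y \<otimes>\<^bsub>R\<^esub> x = x \<and>
     y \<otimes>\<^bsub>R\<^esub> x \<otimes>\<^bsub>R\<^esub> y = y \<and>
     x \<otimes>\<^bsub>R\<^esub> y = y \<otimes>\<^bsub>R\<^esub> x"

definition group_invertible :: "('a, 'm) ring_scheme \<Rightarrow> 'a \<Rightarrow> bool" where
  "group_invertible R x \<longleftrightarrow> (\<exists>y. is_group_inverse R x y)"

text \<open>The value is unspecified when no group inverse exists.\<close>

definition group_inv :: "('a, 'm) ring_scheme \<Rightarrow> 'a \<Rightarrow> 'a" where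
  "group_inv R x = (THE y. is_group_inverse R x y)"

lemma (in ring) is_group_inverse_unique:
  assumes x: "x \<in> carrier R"
    and y: "is_group_inverse R x y" and z: "is_group_inverse R x z"
  shows "y = z"
proof -
  have c: "y \<in> carrier R" "z \<in> carrier R"
    and xy: "x \<otimes> y = y \<otimes> x" and xz: "x \<otimes> z = z \<otimes> x"
    and y1: "x \<otimes> y \<otimes> x = x" and z1: "x \<otimes> z \<otimes> x = x"
    and y2: "y \<otimes> x \<otimes> y = y" and z2: "z \<otimes> x \<otimes> z = z"
    using y z by (auto simp: is_group_inverse_def)
  have "x \<otimes> y = (x \<otimes> z \<otimes> x) \<otimes> y" by (simp add: z1)
  also have "\<dots> = z \<otimes> x \<otimes> (x \<otimes> y)" using x c by (simp add: xz m_assoc)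
  also have "\<dots> = z \<otimes> (x \<otimes> y \<otimes> x)"
    by (subst xy) (use x c in \<open>simp add: m_assoc\<close>)
  finally have e: "x \<otimes> y = z \<otimes> x" by (simp add: y1)
  have "y = y \<otimes> (x \<otimes> y)" using x c y2 by (simp add: m_assoc)
  also have "\<dots> = y \<otimes> (x \<otimes> z)" by (simp add: e xz)
  also have "\<dots> = z \<otimes> x \<otimes> z" using x c e xy by (simp flip: m_assoc)
  finally show ?thesis by (simp add: z2)
qed

lemma (in ring) group_inv_is_group_inverse:
  assumes "x \<in> carrier R" "group_invertible R x"
  shows "is_group_inverse R x (group_inv R x)"
  unfolding group_inv_def using assms
  by (metis group_invertible_def is_group_inverse_unique theI')

definition K_elem :: "('a, 'm) ring_scheme \<Rightarrow> 'a \<Rightarrow> 'a \<Rightarrow> 'a" where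
  "K_elem R a b =
     (b \<otimes>\<^bsub>R\<^esub> group_inv R b \<oplus>\<^bsub>R\<^esub> a \<otimes>\<^bsub>R\<^esub> group_inv R a) \<ominus>\<^bsub>R\<^esub> \<one>\<^bsub>R\<^esub>"

definition spectral_idem :: "('a, 'm) ring_scheme \<Rightarrow> 'a \<Rightarrow> 'a" where
  "spectral_idem R a = \<one>\<^bsub>R\<^esub> \<ominus>\<^bsub>R\<^esub> group_inv R a \<otimes>\<^bsub>R\<^esub> a"

text \<open>The element \<open>\<Phi>(a)\<close> for the perturbation \<open>\<delta>a = d\<close>. It is meaningful only when
  \<open>1 + a\<^sup># d\<close> is a unit, which holds whenever \<open>K(a, a + d)\<close> is one.\<close>

definition Phi :: "('a, 'm) ring_scheme \<Rightarrow> 'a \<Rightarrow> 'a \<Rightarrow> 'a" where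
  "Phi R a d =
     \<one>\<^bsub>R\<^esub> \<oplus>\<^bsub>R\<^esub> d \<otimes>\<^bsub>R\<^esub> spectral_idem R a \<otimes>\<^bsub>R\<^esub> d \<otimes>\<^bsub>R\<^esub>
       (inv\<^bsub>R\<^esub> (\<one>\<^bsub>R\<^esub> \<oplus>\<^bsub>R\<^esub> group_inv R a \<otimes>\<^bsub>R\<^esub> d) \<otimes>\<^bsub>R\<^esub> group_inv R a) [^]\<^bsub>R\<^esub> (2::nat)"

end

(* Write b = a + d, p = a a^#, q = b b^# and k = K(a, b) = p + q - 1. Since kp = qp and kq = pq,
   conjugation by the unit k exchanges p and q, and so every x that is invertible in the corner
   ring qRq, with inverse y, has a compression p x p that is invertible in pRp, with inverse
   k^-1 y k^-1. Let c and e be the inverses of p b p and p b^2 p obtained in this way. Then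
   (1 + a^# d)^-1 = 1 - c d, hence (1 + a^# d)^-1 a^# = c and Phi(a) = 1 + b (1 - p) b c^2.
   The p-corner of Phi(a) is p b^2 p c^2, which has the inverse p b p b e, and
   Phi(a) - 1 vanishes on 1 - p. *)

theory Submission
  imports Defs
begin

context ring
begin

text \<open>The library's noncommutative setup of the method \<open>algebra\<close> lacks this rule.\<close>

lemmas [algebra add: ring "zero R" "add R" "a_inv R" "a_minus R" "one R" "mult R"] = r_one

text \<open>The hypotheses make \<open>y\<close> a quasi-inverse of \<open>x\<close>: they cancel
  all terms but 1 when (1 + x)(1 - y) and (1 - y)(1 + x) are expanded. Used for 1 + a^# d, where the
  value of the inverse matters, and for Phi(a).\<close>

lemma Units_one_plus:
  assumes "x \<in> carrier R" "y \<in> carrier R" "x \<otimes> y = x \<ominus> y" "y \<otimes> x = x \<ominus> y"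
  shows "\<one> \<oplus> x \<in> Units R" and "inv (\<one> \<oplus> x) = \<one> \<ominus> y"
proof -
  have "(\<one> \<oplus> x) \<otimes> (\<one> \<ominus> y) = \<one> \<oplus> x \<ominus> y \<ominus> x \<otimes> y"
    using assms(1,2) by algebra
  also have "\<dots> = \<one>" unfolding assms(3) using assms(1,2) by algebra
  finally have r: "(\<one> \<oplus> x) \<otimes> (\<one> \<ominus> y) = \<one>" .
  have "(\<one> \<ominus> y) \<otimes> (\<one> \<oplus> x) = \<one> \<oplus> x \<ominus> y \<ominus> y \<otimes> x"
    using assms(1,2) by algebra
  also have "\<dots> = \<one>" unfolding assms(4) using assms(1,2) by algebra
  finally have l: "(\<one> \<ominus> y) \<otimes> (\<one> \<oplus> x) = \<one>" .
  show "\<one> \<oplus> x \<in> Units R"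
    unfolding Units_def using assms(1,2) l r by blast
  show "inv (\<one> \<oplus> x) = \<one> \<ominus> y"
    using assms(1,2) l r by (intro inv_char) auto
qed

text \<open>Here \<open>y\<close> is the inverse of \<open>x\<close> in the corner ring qRq, and
  \<open>c\<close> becomes the inverse of pxp in pRp. The last two equations can drop a factor
  \<open>p\<close> because pc = c = cp.\<close>

lemma compression_inverse:
  assumes p: "p \<in> carrier R" "p \<otimes> p = p"
    and q: "q \<in> carrier R" "q \<otimes> q = q"
    and k: "p \<oplus> q \<ominus> \<one> \<in> Units R"
    and x: "x \<in> carrier R" "q \<otimes> x = x" "x \<otimes> q = x"
    and y: "y \<in> carrier R" "q \<otimes> y = y" "y \<otimes> q = y"
    and xy: "x \<otimes> y = q" "y \<otimes> x = q"
  obtains c where "c \<in> carrier R" "p \<otimes> c = c" "c \<otimes> p = c"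
    "p \<otimes> (x \<otimes> c) = p" "c \<otimes> (x \<otimes> p) = p"
proof -
  define k where "k = p \<oplus> q \<ominus> \<one>"
  define l where "l = inv k"
  have kl: "k \<in> carrier R" "l \<in> carrier R" "k \<otimes> l = \<one>" "l \<otimes> k = \<one>"
    using assms(5) by (auto simp: k_def l_def)
  have "p \<otimes> k = p \<otimes> p \<oplus> p \<otimes> q \<ominus> p" unfolding k_def using p(1) q(1) by algebra
  also have "\<dots> = p \<otimes> q" unfolding p(2) using p(1) q(1) by algebra
  finally have pk: "p \<otimes> k = p \<otimes> q" .
  have "k \<otimes> p = p \<otimes> p \<oplus> q \<otimes> p \<ominus> p" unfolding k_def using p(1) q(1) by algebra
  also have "\<dots> = q \<otimes> p" unfolding p(2) using p(1) q(1) by algebra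
  finally have kp: "k \<otimes> p = q \<otimes> p" .
  have "q \<otimes> k = q \<otimes> p \<oplus> q \<otimes> q \<ominus> q" unfolding k_def using p(1) q(1) by algebra
  also have "\<dots> = q \<otimes> p" unfolding q(2) using p(1) q(1) by algebra
  finally have qk: "q \<otimes> k = q \<otimes> p" .
  have "k \<otimes> q = p \<otimes> q \<oplus> q \<otimes> q \<ominus> q" unfolding k_def using p(1) q(1) by algebra
  also have "\<dots> = p \<otimes> q" unfolding q(2) using p(1) q(1) by algebra
  finally have kq: "k \<otimes> q = p \<otimes> q" .
  \<comment> \<open>Multiplying the four products with \<open>k\<close> by its inverse
    \<open>l\<close> gives pql = lqp = p and qpl = lpq = q. These yield that \<open>l\<close>
    intertwines \<open>p\<close> and \<open>q\<close>.\<close>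
  have pql: "p \<otimes> (q \<otimes> l) = p"
    using pk kl p q by (metis m_assoc r_one)
  have lqp: "l \<otimes> (q \<otimes> p) = p"
    using kp kl p q by (metis m_assoc l_one)
  have qpl: "q \<otimes> (p \<otimes> l) = q"
    using qk kl p q by (metis m_assoc r_one)
  have lpq: "l \<otimes> (p \<otimes> q) = q"
    using kq kl p q by (metis m_assoc l_one)
  have pl: "p \<otimes> l = l \<otimes> q"
  proof -
    have "l \<otimes> q = l \<otimes> (q \<otimes> (p \<otimes> l))" by (simp add: qpl)
    also have "\<dots> = l \<otimes> (q \<otimes> p) \<otimes> l" using p q kl by (simp add: m_assoc)
    finally show ?thesis by (simp add: lqp)
  qed
  have lp: "l \<otimes> p = q \<otimes> l"
  proof -
    have "l \<otimes> p = l \<otimes> (p \<otimes> (q \<otimes> l))" by (simp add: pql)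
    also have "\<dots> = l \<otimes> (p \<otimes> q) \<otimes> l" using p q kl by (simp add: m_assoc)
    finally show ?thesis by (simp add: lpq)
  qed
  \<comment> \<open>Since pl = lq and lp = ql, the map sending y to lyl carries qRq into
    pRp.\<close>
  define c where "c = l \<otimes> (y \<otimes> l)"
  have c: "c \<in> carrier R" using kl y by (simp add: c_def)
  have pc: "p \<otimes> c = c"
  proof -
    have "p \<otimes> c = (p \<otimes> l) \<otimes> (y \<otimes> l)" using p kl y by (simp add: c_def m_assoc)
    also have "\<dots> = l \<otimes> ((q \<otimes> y) \<otimes> l)" unfolding pl using q kl y(1) by (simp add: m_assoc)
    finally show ?thesis by (simp add: y(2) c_def)
  qed
  have cp: "c \<otimes> p = c"
  proof -
    have "c \<otimes> p = l \<otimes> (y \<otimes> (l \<otimes> p))" using p kl y by (simp add: c_def m_assoc)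
    also have "\<dots> = l \<otimes> ((y \<otimes> q) \<otimes> l)" unfolding lp using q kl y(1) by (simp add: m_assoc)
    finally show ?thesis by (simp add: y(3) c_def)
  qed
  \<comment> \<open>Inserting \<open>q\<close> after \<open>x\<close> and \<open>p\<close> before
    \<open>c\<close> creates the factor qpl = q, which absorbs the first \<open>l\<close> of
    \<open>c\<close>. Thus xc = xyl = ql, and pql = p.\<close>
  have "x \<otimes> c = (x \<otimes> q) \<otimes> (p \<otimes> c)" by (simp add: pc x)
  also have "\<dots> = x \<otimes> ((q \<otimes> (p \<otimes> l)) \<otimes> (y \<otimes> l))"
    using p q kl x(1) y(1) by (simp add: c_def m_assoc)
  also have "\<dots> = (x \<otimes> q) \<otimes> y \<otimes> l"
    unfolding qpl using q kl x(1) y(1) by (simp add: m_assoc)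
  finally have 1: "p \<otimes> (x \<otimes> c) = p" by (simp add: x xy pql)
  have "c \<otimes> x = (c \<otimes> p) \<otimes> (q \<otimes> x)" by (simp add: cp x)
  also have "\<dots> = l \<otimes> (y \<otimes> (l \<otimes> (p \<otimes> q)) \<otimes> x)"
    using p q kl x(1) y(1) by (simp add: c_def m_assoc)
  also have "\<dots> = l \<otimes> q" by (simp add: lpq y xy)
  finally have "c \<otimes> (x \<otimes> p) = l \<otimes> (q \<otimes> p)"
    using c p x q kl by (simp flip: m_assoc)
  then have 2: "c \<otimes> (x \<otimes> p) = p" by (simp add: lqp)
  show thesis using that c pc cp 1 2 .
qed

lemma Units_Phi:
  assumes "a \<in> carrier R" "d \<in> carrier R"
    and "group_invertible R a" "group_invertible R (a \<oplus> d)"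
    and "K_elem R a (a \<oplus> d) \<in> Units R"
  shows "Phi R a d \<in> Units R"
proof -
  define b where "b = a \<oplus> d"
  define g where "g = group_inv R a"
  define h where "h = group_inv R b"
  define p where "p = a \<otimes> g"
  define q where "q = b \<otimes> h"
  have ad: "a \<in> carrier R" "d \<in> carrier R" using assms by auto
  have b: "b \<in> carrier R" using ad by (simp add: b_def)
  have d: "d = b \<ominus> a" unfolding b_def using ad by algebra
  have "is_group_inverse R a g"
    using assms group_inv_is_group_inverse g_def by blast
  then have g: "g \<in> carrier R" "a \<otimes> g \<otimes> a = a" "g \<otimes> a \<otimes> g = g" and ga: "g \<otimes> a = p"
    by (auto simp: is_group_inverse_def p_def)
  have "is_group_inverse R b h"
    using assms b group_inv_is_group_inverse h_def b_def by blast
  then have h: "h \<in> carrier R" "b \<otimes> h \<otimes> b = b" "h \<otimes> b \<otimes> h = h" and hb: "h \<otimes> b = q"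
    by (auto simp: is_group_inverse_def q_def)
  have p: "p \<in> carrier R" "p \<otimes> p = p" "p \<otimes> a = a" "a \<otimes> p = a" "p \<otimes> g = g" "g \<otimes> p = g"
    using ad g ga by (simp_all add: p_def) (metis m_assoc m_closed)+
  have q: "q \<in> carrier R" "q \<otimes> q = q" "q \<otimes> b = b" "b \<otimes> q = b" "q \<otimes> h = h" "h \<otimes> q = h"
    using b h hb by (simp_all add: q_def) (metis m_assoc m_closed)+
  have "K_elem R a b = q \<oplus> p \<ominus> \<one>" by (simp add: K_elem_def p_def q_def g_def h_def)
  then have K: "p \<oplus> q \<ominus> \<one> \<in> Units R"
    using assms(5) p(1) q(1) by (simp add: b_def a_comm)
  \<comment> \<open>In qRq the inverse of \<open>b\<close> is \<open>h\<close>, because bh = hb = q;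
    likewise the inverse of b^2 is h^2 below.\<close>
  obtain c where c: "c \<in> carrier R" "p \<otimes> c = c" "c \<otimes> p = c"
    "p \<otimes> (b \<otimes> c) = p" "c \<otimes> (b \<otimes> p) = p"
    using compression_inverse[OF p(1,2) q(1,2) K b q(3,4) h(1) q(5,6)] hb q_def by metis
  have "b \<otimes> b \<otimes> (h \<otimes> h) = b \<otimes> (b \<otimes> h) \<otimes> h" "h \<otimes> h \<otimes> (b \<otimes> b) = h \<otimes> (h \<otimes> b) \<otimes> b"
    using b h by (simp_all add: m_assoc)
  then have bbhh: "b \<otimes> b \<otimes> (h \<otimes> h) = q" "h \<otimes> h \<otimes> (b \<otimes> b) = q"
    by (simp_all add: hb q flip: q_def)
  have bb: "b \<otimes> b \<in> carrier R" "q \<otimes> (b \<otimes> b) = b \<otimes> b" "b \<otimes> b \<otimes> q = b \<otimes> b"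
    and hh: "h \<otimes> h \<in> carrier R" "q \<otimes> (h \<otimes> h) = h \<otimes> h" "h \<otimes> h \<otimes> q = h \<otimes> h"
    using b h(1) q by (simp, metis m_assoc, metis m_assoc, simp, metis m_assoc, metis m_assoc)
  obtain e where e: "e \<in> carrier R" "p \<otimes> e = e" "e \<otimes> p = e"
    "p \<otimes> (b \<otimes> b \<otimes> e) = p" "e \<otimes> (b \<otimes> b \<otimes> p) = p"
    using compression_inverse[OF p(1,2) q(1,2) K bb hh bbhh] by metis

  \<comment> \<open>Since gp = g = pg, a factor \<open>p\<close> may be inserted beside
    \<open>g\<close>, where pbc = p and cbp = p apply.\<close>
  have gbc: "g \<otimes> (b \<otimes> c) = g"
  proof -
    have "g \<otimes> (b \<otimes> c) = g \<otimes> (p \<otimes> (b \<otimes> c))" using g(1) b c(1) p by (simp flip: m_assoc)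
    then show ?thesis by (simp add: c p)
  qed
  have cbg: "c \<otimes> (b \<otimes> g) = g"
  proof -
    have "c \<otimes> (b \<otimes> g) = c \<otimes> (b \<otimes> p) \<otimes> g" using g(1) b c(1) p by (simp add: m_assoc)
    then show ?thesis by (simp add: c p)
  qed
  \<comment> \<open>With d = b - a this gives gdc = g - c = cdg. Multiplied by \<open>d\<close> on
    the right, these say that cd is a quasi-inverse of gd.\<close>
  have "g \<otimes> d \<otimes> c = g \<otimes> (b \<otimes> c) \<ominus> (g \<otimes> a) \<otimes> c" unfolding d using g(1) ad b c(1) by algebra
  then have gdc: "g \<otimes> d \<otimes> c = g \<ominus> c" by (simp add: gbc ga c)
  have "c \<otimes> d \<otimes> g = c \<otimes> (b \<otimes> g) \<ominus> c \<otimes> (a \<otimes> g)" unfolding d using g(1) ad b c(1) by algebra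
  then have cdg: "c \<otimes> d \<otimes> g = g \<ominus> c" by (simp add: cbg c flip: p_def)
  have "g \<otimes> d \<otimes> (c \<otimes> d) = (g \<otimes> d \<otimes> c) \<otimes> d" using g(1) ad c(1) by (simp add: m_assoc)
  also have "\<dots> = g \<otimes> d \<ominus> c \<otimes> d" unfolding gdc using g(1) ad c(1) by algebra
  finally have 1: "g \<otimes> d \<otimes> (c \<otimes> d) = g \<otimes> d \<ominus> c \<otimes> d" .
  have "c \<otimes> d \<otimes> (g \<otimes> d) = (c \<otimes> d \<otimes> g) \<otimes> d" using g(1) ad c(1) by (simp add: m_assoc)
  also have "\<dots> = g \<otimes> d \<ominus> c \<otimes> d" unfolding cdg using g(1) ad c(1) by algebra
  finally have 2: "c \<otimes> d \<otimes> (g \<otimes> d) = g \<otimes> d \<ominus> c \<otimes> d" .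
  have "inv (\<one> \<oplus> g \<otimes> d) = \<one> \<ominus> c \<otimes> d"
    using Units_one_plus(2)[OF _ _ 1 2] g(1) ad c(1) by simp
  then have "inv (\<one> \<oplus> g \<otimes> d) \<otimes> g = g \<ominus> c \<otimes> d \<otimes> g" using g(1) ad c(1) by algebra
  also have "\<dots> = c" unfolding cdg using g(1) c(1) by algebra
  finally have inv_g: "inv (\<one> \<oplus> g \<otimes> d) \<otimes> g = c" .

  define x where "x = b \<otimes> (\<one> \<ominus> p) \<otimes> b \<otimes> (c \<otimes> c)"
  have x: "x \<in> carrier R" using b p c by (simp add: x_def)
  \<comment> \<open>Both \<open>d\<close> may be replaced by \<open>b\<close> because (1 - p)a = 0 =
    a(1 - p); the subtracted terms are displayed so that they visibly vanish.\<close>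
  have "d \<otimes> (\<one> \<ominus> p) \<otimes> d =
      b \<otimes> (\<one> \<ominus> p) \<otimes> b \<ominus> b \<otimes> (a \<ominus> p \<otimes> a) \<ominus> (a \<ominus> a \<otimes> p) \<otimes> (b \<ominus> a)"
    unfolding d using ad b p(1) by algebra
  also have "\<dots> = b \<otimes> (\<one> \<ominus> p) \<otimes> b"
    unfolding p(3,4) using ad b p(1) by algebra
  finally have Phi: "Phi R a d = \<one> \<oplus> x"
    using c(1) by (simp add: Phi_def spectral_idem_def inv_g ga numeral_2_eq_2 x_def flip: g_def)

  have "x \<otimes> p = b \<otimes> (\<one> \<ominus> p) \<otimes> b \<otimes> (c \<otimes> (c \<otimes> p))"
    using b p(1) c(1) by (simp add: x_def m_assoc)
  then have xp: "x \<otimes> p = x" by (simp add: c x_def)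
  \<comment> \<open>Two uses of pbc = p reduce pbpbc^2 to \<open>p\<close>, so p + px =
    pb^2c^2.\<close>
  have "p \<otimes> x = p \<otimes> (b \<otimes> b \<otimes> (c \<otimes> c)) \<ominus> (p \<otimes> (b \<otimes> (p \<otimes> (b \<otimes> c)))) \<otimes> c"
    unfolding x_def using b p(1) c(1) by algebra
  also have "p \<otimes> (b \<otimes> (p \<otimes> (b \<otimes> c))) \<otimes> c = p \<otimes> (b \<otimes> (p \<otimes> c))"
    using b p(1) c(1) by (simp add: c(4) m_assoc)
  finally have px: "p \<otimes> x = p \<otimes> (b \<otimes> b \<otimes> (c \<otimes> c)) \<ominus> p" by (simp add: c)

  \<comment> \<open>In pRp, \<open>c\<close> inverts pbp and \<open>e\<close> inverts pb^2p. Hence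
    the inverse of p + px = (pb^2p)c^2 is (pbp)^2 e, which is \<open>w\<close>.\<close>
  define w where "w = p \<otimes> (b \<otimes> (p \<otimes> (b \<otimes> e)))"
  have w: "w \<in> carrier R" using b p e by (simp add: w_def)
  have pw: "p \<otimes> w = w" using b p e by (simp add: w_def flip: m_assoc)
  have wp: "w \<otimes> p = w" using b p e by (simp add: w_def m_assoc)
  have "c \<otimes> w = (c \<otimes> p) \<otimes> (b \<otimes> (p \<otimes> (b \<otimes> e)))" 
    using b p(1) c(1) e(1) by (simp add: w_def m_assoc)
  also have "\<dots> = (c \<otimes> (b \<otimes> p)) \<otimes> (b \<otimes> e)"
    unfolding c(3) using b p(1) c(1) e(1) by (simp add: m_assoc)
  finally have "c \<otimes> w = p \<otimes> (b \<otimes> e)" by (simp add: c)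
  then have "c \<otimes> c \<otimes> w = (c \<otimes> p) \<otimes> (b \<otimes> (p \<otimes> e))"
    using b p(1) c(1) e w by (simp add: m_assoc)
  also have "\<dots> = (c \<otimes> (b \<otimes> p)) \<otimes> e"
    unfolding c(3) using b p(1) c(1) e(1) by (simp add: m_assoc)
  finally have ccw: "c \<otimes> c \<otimes> w = e" by (simp add: c e)
  have "p \<otimes> x \<otimes> w = p \<otimes> (b \<otimes> b \<otimes> (c \<otimes> c \<otimes> w)) \<ominus> p \<otimes> w"
    unfolding px using b p(1) c(1) w by algebra
  then have pxw: "p \<otimes> x \<otimes> w = p \<ominus> w" by (simp add: ccw e pw)
  \<comment> \<open>As x = xp, the inverse of 1 + x is 1 - xw, with \<open>w\<close> the inverse of
    p + px in pRp. So xw has to be a quasi-inverse of \<open>x\<close>; this side uses (p + px)w =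
    p.\<close>
  have "x \<otimes> (x \<otimes> w) = (x \<otimes> p) \<otimes> (x \<otimes> w)" by (simp add: xp)
  also have "\<dots> = x \<otimes> (p \<otimes> x \<otimes> w)" using x p(1) w by (simp add: m_assoc)
  also have "\<dots> = x \<otimes> p \<ominus> x \<otimes> w" unfolding pxw using x p(1) w by algebra
  finally have xxw: "x \<otimes> (x \<otimes> w) = x \<ominus> x \<otimes> w" by (simp add: xp)

  \<comment> \<open>This is w(p + px) = p. Writing c = pc exposes eb^2p = p inside \<open>w\<close>;
    what is left, pbpbc^2, collapses by pbc = p.\<close>
  have "w \<otimes> (p \<otimes> (b \<otimes> b \<otimes> (c \<otimes> c))) = w \<otimes> (b \<otimes> b \<otimes> (p \<otimes> c \<otimes> c))"
    using b p(1) c(1) w by (simp add: c wp flip: m_assoc)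
  also have "\<dots> = p \<otimes> (b \<otimes> (p \<otimes> (b \<otimes> (e \<otimes> (b \<otimes> b \<otimes> p) \<otimes> c \<otimes> c))))"
    using b p(1) c(1) e(1) by (simp add: w_def m_assoc)
  also have "\<dots> = p \<otimes> (b \<otimes> ((p \<otimes> (b \<otimes> (p \<otimes> c))) \<otimes> c))"
    unfolding e(5) using b p(1) c(1) by (simp add: m_assoc)
  also have "\<dots> = p" by (simp add: c)
  finally have wbbcc: "w \<otimes> (p \<otimes> (b \<otimes> b \<otimes> (c \<otimes> c))) = p" .
  have "x \<otimes> w \<otimes> x = x \<otimes> (w \<otimes> p) \<otimes> x" by (simp add: wp)
  also have "\<dots> = x \<otimes> (w \<otimes> (p \<otimes> x))" using x p(1) w by (simp add: m_assoc)
  also have "\<dots> = x \<otimes> (w \<otimes> (p \<otimes> (b \<otimes> b \<otimes> (c \<otimes> c)))) \<ominus> x \<otimes> (w \<otimes> p)"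
    unfolding px using x p(1) w b c(1) by algebra
  finally have xwx: "x \<otimes> w \<otimes> x = x \<ominus> x \<otimes> w" by (simp add: wbbcc xp wp)
  show ?thesis
    using Units_one_plus(1)[OF x _ xxw xwx] x w Phi by simp
qed

end

theorem theorem3p4:
  fixes R :: "('a, 'm) ring_scheme" and a \<delta>a :: 'a
  assumes "ring R"
    and "a \<in> carrier R" and "\<delta>a \<in> carrier R"
    and "group_invertible R a"
    and "group_invertible R (a \<oplus>\<^bsub>R\<^esub> \<delta>a)"
    and "K_elem R a (a \<oplus>\<^bsub>R\<^esub> \<delta>a) \<in> Units R"
  shows "Phi R a \<delta>a \<in> Units R"
  using ring.Units_Phi[OF assms] .

end
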